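(* Let $S\subseteq\mathbb{Z}_2^n$ be a Sidon set with $0\notin S$ that generates $\mathbb{Z}_2^n$. Then $Q_S$ admits a unitary signing if and only if $S$ has the $\Theta$-property. Furthermore, $Q_S$ admits an orthogonal signing if and only if $S$ has the $\Theta$-property and has no minimal dependency relation whose size is congruent to $2$ or $3$ modulo $4$.
   Context: For $S\subseteq\mathbb{Z}_2^n$ with $0\notin S$, $Q_S$ is the (loopless, simple) graph with vertex set $\mathbb{Z}_2^n$ in which $x,y$ are adjacent iff $x+y\in S$. $S$ is a Sidon set if for all $a,b,c,d\in S$ with $a\ne b$, $c\neq d$ and $a+b=c+d$ one has $\{a,b\}=\{c,d\}$. $\Theta$-property: for any three pairwise disjoint subsets of $S$ whose element sums are equal, at least two of the three subsets have even size. (An empty subset is allowed; its sum is $0$.) A dependency relation of $S$ is a subset $D\subseteq S$ with $\sum_{d\in D}d=0$; it is minimal if it is nonempty and contains no smaller nonempty dependency relation. A complex signing of a graph $G$ assigns to each ordered pair $(x,y)$ of adjacent vertices a value $\sigma(xy)\in\{1,-1,i,-i\}$ such that $\sigma(yx)=\overline{\sigma(xy)}$. Its adjacency matrix $M$ ($M_{xy}=\sigma(xy)$ for adjacent $x,y$, and $0$ otherwise) is Hermitian. For a $d$-regular graph the signing is unitary if $M^2=dI$; a unitary signing is orthogonal if all its values lie in $\{1,-1\}$. *)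

theory Defs
  imports
    Complex_Main
    "HOL-Library.Z2"
    "HOL-Library.Function_Algebras"
    "HOL-Computational_Algebra.Group_Closure"
    "Graph_Theory.Pair_Digraph"
begin

text \<open>
  The group \<open>\<int>\<^sub>2\<^sup>n\<close> is the set of functions \<^typ>\<open>nat \<Rightarrow> bit\<close> that vanish
  at all indices \<open>\<ge> n\<close>; addition is the pointwise one of
  \<^theory>\<open>HOL-Library.Function_Algebras\<close>. In this way \<open>n = 0\<close> is included.
\<close>

definition Z2n :: "nat \<Rightarrow> (nat \<Rightarrow> bit) set" where
  "Z2n n = {x. \<forall>i\<ge>n. x i = 0}"

text \<open>
  A simple graph is a \<^const>\<open>pair_graph\<close>: finite, loopless, with a symmetric set \<^const>\<open>parcs\<close>
  of ordered pairs of adjacent vertices. Lemma \<open>pair_graph_QS\<close> below shows that \<open>QS n S\<close> is one.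
\<close>

definition QS :: "nat \<Rightarrow> (nat \<Rightarrow> bit) set \<Rightarrow> (nat \<Rightarrow> bit) pair_pre_digraph" where
  "QS n S = \<lparr> pverts = Z2n n, parcs = {(x, y). x \<in> Z2n n \<and> y \<in> Z2n n \<and> x + y \<in> S} \<rparr>"

definition sidon :: "'a::comm_monoid_add set \<Rightarrow> bool" where
  "sidon S \<longleftrightarrow> (\<forall>a\<in>S. \<forall>b\<in>S. \<forall>c\<in>S. \<forall>d\<in>S.
     a \<noteq> b \<and> c \<noteq> d \<and> a + b = c + d \<longrightarrow> {a, b} = {c, d})"

definition theta_property :: "'a::comm_monoid_add set \<Rightarrow> bool" where
  "theta_property S \<longleftrightarrow> (\<forall>A B C. A \<subseteq> S \<and> B \<subseteq> S \<and> C \<subseteq> S \<and>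
     A \<inter> B = {} \<and> A \<inter> C = {} \<and> B \<inter> C = {} \<and> \<Sum>A = \<Sum>B \<and> \<Sum>B = \<Sum>C \<longrightarrow>
     even (card A) \<and> even (card B) \<or> even (card A) \<and> even (card C) \<or>
     even (card B) \<and> even (card C))"

definition dependency_relation :: "'a::comm_monoid_add set \<Rightarrow> 'a set \<Rightarrow> bool" where
  "dependency_relation S D \<longleftrightarrow> D \<subseteq> S \<and> \<Sum>D = 0"

definition minimal_dependency_relation :: "'a::comm_monoid_add set \<Rightarrow> 'a set \<Rightarrow> bool" where
  "minimal_dependency_relation S D \<longleftrightarrow> dependency_relation S D \<and> D \<noteq> {} \<and>
     \<not> (\<exists>D'. D' \<subset> D \<and> D' \<noteq> {} \<and> dependency_relation S D')"

definition complex_signing :: "'v pair_pre_digraph \<Rightarrow> ('v \<Rightarrow> 'v \<Rightarrow> complex) \<Rightarrow> bool" where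
  "complex_signing G \<sigma> \<longleftrightarrow>
     (\<forall>(x, y)\<in>parcs G. \<sigma> x y \<in> {1, -1, \<i>, -\<i>} \<and> \<sigma> y x = cnj (\<sigma> x y))"

definition signed_adjacency ::
  "'v pair_pre_digraph \<Rightarrow> ('v \<Rightarrow> 'v \<Rightarrow> complex) \<Rightarrow> 'v \<Rightarrow> 'v \<Rightarrow> complex" where
  "signed_adjacency G \<sigma> x y = (if (x, y) \<in> parcs G then \<sigma> x y else 0)"

definition regular_graph :: "'v pair_pre_digraph \<Rightarrow> nat \<Rightarrow> bool" where
  "regular_graph G d \<longleftrightarrow> (\<forall>x\<in>pverts G. card {y. (x, y) \<in> parcs G} = d)"

text \<open>Last conjunct: the entries of \<open>M\<^sup>2 = d I\<close>, where \<open>M\<close> is indexed by the vertices of \<open>G\<close>.\<close>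

definition unitary_signing :: "'v pair_pre_digraph \<Rightarrow> ('v \<Rightarrow> 'v \<Rightarrow> complex) \<Rightarrow> bool" where
  "unitary_signing G \<sigma> \<longleftrightarrow> complex_signing G \<sigma> \<and>
     (\<exists>d. regular_graph G d \<and>
       (\<forall>x\<in>pverts G. \<forall>y\<in>pverts G.
          (\<Sum>z\<in>pverts G. signed_adjacency G \<sigma> x z * signed_adjacency G \<sigma> z y) =
          (if x = y then of_nat d else 0)))"

definition orthogonal_signing :: "'v pair_pre_digraph \<Rightarrow> ('v \<Rightarrow> 'v \<Rightarrow> complex) \<Rightarrow> bool" where
  "orthogonal_signing G \<sigma> \<longleftrightarrow> unitary_signing G \<sigma> \<and>
     (\<forall>(x, y)\<in>parcs G. \<sigma> x y \<in> {1, -1})"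

lemma finite_Z2n: "finite (Z2n n)"
proof (rule finite_subset)
  show "Z2n n \<subseteq> (\<lambda>I i. if i \<in> I then 1 else 0) ` Pow {..<n}"
  proof
    fix x assume "x \<in> Z2n n"
    then have "{i. x i = 1} \<subseteq> {..<n}"
      by (force simp: Z2n_def not_less[symmetric])
    moreover have "x = (\<lambda>i. if i \<in> {i. x i = 1} then 1 else 0)"
      by (auto simp: fun_eq_iff)
    ultimately show "x \<in> (\<lambda>I i. if i \<in> I then 1 else 0) ` Pow {..<n}"
      by blast
  qed
qed simp

lemma Z2_fun_add_self: "x + x = (0 :: nat \<Rightarrow> bit)"
  by (simp add: fun_eq_iff)

lemma pair_graph_QS:
  assumes "0 \<notin> S"
  shows "pair_graph (QS n S)"
proof
  show "finite (parcs (QS n S))"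
    by (rule finite_subset[of _ "Z2n n \<times> Z2n n"]) (auto simp: QS_def finite_Z2n)
  show "symmetric (with_proj (QS n S))"
    by (auto simp: symmetric_def sym_def QS_def add.commute)
qed (use assms in \<open>auto simp: QS_def finite_Z2n Z2_fun_add_self\<close>)

lemma regular_graph_QS:
  assumes "S \<subseteq> Z2n n"
  shows "regular_graph (QS n S) (card S)"
  unfolding regular_graph_def
proof
  fix x assume "x \<in> pverts (QS n S)"
  then have x: "x \<in> Z2n n" by (simp add: QS_def)
  have cancel: "x + (x + y) = y" for y
    by (simp add: add.assoc[symmetric] Z2_fun_add_self)
  have "bij_betw (\<lambda>s. x + s) S {y. (x, y) \<in> parcs (QS n S)}"
    by (rule bij_betw_byWitness[where f' = "\<lambda>y. x + y"])
      (use assms x cancel in \<open>auto simp: QS_def Z2n_def\<close>)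
  then show "card {y. (x, y) \<in> parcs (QS n S)} = card S"
    by (metis bij_betw_same_card)
qed

end

theory Submission
  imports Defs
begin

text \<open>
  Because \<open>S\<close> is a Sidon set, a signing is unitary iff every four-cycle \<open>x, x + a, x + a + b, x + b\<close>
  has sign \<open>-1\<close>. Read along walks, this says that the letters of \<open>S\<close> act as anticommuting
  involutions, so that walks behave like monomials of a Clifford algebra. The closed walks spelling
  dependency relations \<open>D\<close> and \<open>E\<close> are scalars, hence commute, which forces
  \<open>card D * card E + card (D \<inter> E)\<close> to be even; this is the Theta-property. Reversing a closed walk
  conjugates its value and multiplies it by \<open>(-1) ^ (card D choose 2)\<close>, so a real value forces
  \<open>card D mod 4 \<in> {0, 1}\<close>. Conversely, under the Theta-property the Clifford monomials of the
  dependency relations generate an abelian group, \<open>-1 \<mapsto> -1\<close> extends to a character of it, and the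
  induced representation is given by a signing.
\<close>

section \<open>Arithmetic in characteristic two\<close>

text \<open>These simplification rules would turn field operations on \<^typ>\<open>bit\<close> into Boolean ones and
  sums of functions into abstractions.\<close>

declare add_bit_eq_xor [simp del] mult_bit_eq_and [simp del] plus_fun_apply [simp del]

lemma bit_add_self [simp]: "b + b = (0::bit)"
  by (cases b) simp_all

lemma bit_add_left_self [simp]: "b + (b + c) = (c::bit)"
  by (simp flip: add.assoc)

lemma bit_add_eq_0_iff: "b + c = 0 \<longleftrightarrow> b = (c::bit)"
  by (cases b; cases c) simp_all


lemma fun_bit_add_self [simp]: "x + x = (0 :: 'a \<Rightarrow> bit)"
  by (simp add: fun_eq_iff plus_fun_apply)

text \<open>The arithmetic simplification procedures collect \<open>x + x\<close> into \<open>2 * x\<close>.\<close>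

lemma fun_bit_mult_2 [simp]: "2 * x = (0 :: 'a \<Rightarrow> bit)"
  by (simp add: mult_2)

lemma fun_bit_add_left_self [simp]: "x + (x + y) = (y :: 'a \<Rightarrow> bit)"
  by (simp flip: add.assoc)

lemma fun_bit_add_eq_0_iff: "x + y = 0 \<longleftrightarrow> x = (y :: 'a \<Rightarrow> bit)"
  by (simp add: fun_eq_iff plus_fun_apply bit_add_eq_0_iff)

lemma fun_bit_add_eq_iff: "x + y = z \<longleftrightarrow> y = x + (z :: 'a \<Rightarrow> bit)"
  by auto

lemma even_if_minus_one_power_eq_1: "(-1 :: complex) ^ m = 1 \<Longrightarrow> even m"
  by (cases "even m") simp_all

lemma Z2n_add: "x \<in> Z2n n \<Longrightarrow> y \<in> Z2n n \<Longrightarrow> x + y \<in> Z2n n"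
  by (simp add: Z2n_def plus_fun_apply)

lemma even_choose_two_iff: "even (k choose 2) \<longleftrightarrow> k mod 4 \<in> {0, 1}"
proof (induction k)
  case (Suc k)
  have "Suc k choose 2 = k + (k choose 2)"
    by (simp add: numeral_2_eq_2)
  then show ?case using Suc by simp presburger
qed (simp add: numeral_2_eq_2)

lemma mod_4_add:
  fixes a b :: nat
  assumes "a mod 4 \<in> {0, 1}" "b mod 4 \<in> {0, 1}" "even a \<or> even b"
  shows "(a + b) mod 4 \<in> {0, 1}"
proof -
  have "even (a mod 4) \<or> even (b mod 4)"
    using assms(3) by (simp add: dvd_mod_iff)
  then have "a mod 4 = 0 \<or> b mod 4 = 0" using assms(1,2) by auto
  moreover have "(a + b) mod 4 = (a mod 4 + b mod 4) mod 4" by (simp add: mod_add_eq)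
  ultimately show ?thesis using assms(1,2) by auto
qed

definition bit_sign :: "bit \<Rightarrow> complex" where
  "bit_sign b = (if b = 0 then 1 else -1)"

lemma bit_sign_0 [simp]: "bit_sign 0 = 1"
  and bit_sign_1 [simp]: "bit_sign 1 = -1"
  by (simp_all add: bit_sign_def)

lemma bit_sign_add: "bit_sign (a + b) = bit_sign a * bit_sign b"
  by (cases a; cases b) simp_all

lemma bit_sign_cases: "bit_sign a \<in> {1, -1}"
  by (cases a) simp_all

section \<open>Unitary signings of Cayley graphs of Sidon sets\<close>

text \<open>The Sidon condition leaves \<open>x + a\<close> and \<open>x + b\<close> as the only
  common neighbours of \<open>x\<close> and \<open>x + a + b\<close>, so this off-diagonal entry of
  the squared matrix has exactly two terms.\<close>

lemma sum_two_paths: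
  assumes S: "S \<subseteq> Z2n n" "sidon S" and x: "x \<in> Z2n n"
    and ab: "a \<in> S" "b \<in> S" "a \<noteq> b"
  shows "(\<Sum>z\<in>Z2n n. signed_adjacency (QS n S) \<sigma> x z * signed_adjacency (QS n S) \<sigma> z (x + a + b)) =
    \<sigma> x (x + a) * \<sigma> (x + a) (x + a + b) + \<sigma> x (x + b) * \<sigma> (x + b) (x + a + b)"
proof -
  let ?f = "\<lambda>z. signed_adjacency (QS n S) \<sigma> x z * signed_adjacency (QS n S) \<sigma> z (x + a + b)"
  have V: "x + a \<in> Z2n n" "x + b \<in> Z2n n" "x + a + b \<in> Z2n n"
    using S x ab by (auto intro!: Z2n_add)
  have eqs: "x + (x + a) = a" "x + (x + b) = b" "x + a + (x + a + b) = b" "x + b + (x + a + b) = a"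
    by (simp_all add: ac_simps)
  have "?f z = 0" if z: "z \<in> Z2n n - {x + a, x + b}" for z
  proof (rule ccontr)
    assume "?f z \<noteq> 0"
    then have s: "x + z \<in> S" and t: "z + (x + a + b) \<in> S"
      by (auto simp: signed_adjacency_def QS_def split: if_splits)
    have st: "(x + z) + (z + (x + a + b)) = a + b"
      by (simp add: ac_simps)
    \<comment> \<open>The Sidon condition speaks of pairs of distinct elements; equal steps would
      sum to 0, while \<open>a + b\<close> is nonzero.\<close>
    have "x + z \<noteq> z + (x + a + b)"
      using st ab(3) by (metis fun_bit_add_self fun_bit_add_eq_0_iff)
    then have "{x + z, z + (x + a + b)} = {a, b}"
      using S(2) s t st ab unfolding sidon_def by blast
    then have "x + z = a \<or> x + z = b" by blast
    then have "z = x + a \<or> z = x + b" by (auto simp: fun_bit_add_eq_iff)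
    then show False using z by blast
  qed
  then have "(\<Sum>z\<in>Z2n n. ?f z) = (\<Sum>z\<in>{x + a, x + b}. ?f z)"
    using V by (intro sum.mono_neutral_right) (auto simp: finite_Z2n)
  also have "\<dots> = ?f (x + a) + ?f (x + b)"
    using ab by simp
  also have "\<dots> = \<sigma> x (x + a) * \<sigma> (x + a) (x + a + b) + \<sigma> x (x + b) * \<sigma> (x + b) (x + a + b)"
    using V eqs x ab by (simp add: signed_adjacency_def QS_def)
  finally show ?thesis .
qed

lemma complex_signing_mult_swap:
  assumes "complex_signing G \<sigma>" "(x, y) \<in> parcs G"
  shows "\<sigma> x y * \<sigma> y x = 1"
  using assms by (force simp: complex_signing_def)

text \<open>The diagonal is automatic: each edge traversed back and forth contributes 1. An
  off-diagonal entry either has no nonzero term or is the two-path sum of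
  \<open>sum_two_paths\<close>, which vanishes iff the paths have opposite values.\<close>

lemma unitary_signing_QS_iff:
  assumes S: "S \<subseteq> Z2n n" "sidon S"
  shows "unitary_signing (QS n S) \<sigma> \<longleftrightarrow> complex_signing (QS n S) \<sigma> \<and>
    (\<forall>x\<in>Z2n n. \<forall>a\<in>S. \<forall>b\<in>S. a \<noteq> b \<longrightarrow>
      \<sigma> x (x + a) * \<sigma> (x + a) (x + a + b) = - (\<sigma> x (x + b) * \<sigma> (x + b) (x + a + b)))"
    (is "?U \<longleftrightarrow> ?C \<and> ?N")
proof
  let ?A = "signed_adjacency (QS n S) \<sigma>"
  assume U: ?U
  then have ?C by (simp add: unitary_signing_def)
  moreover have ?N
  proof (intro ballI impI)
    fix x a b assume x: "x \<in> Z2n n" and ab: "a \<in> S" "b \<in> S" "a \<noteq> b"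
    have "x \<noteq> x + a + b"
    proof
      assume "x = x + a + b"
      then have "a + b = 0" by (simp add: add.assoc)
      then show False using ab by (simp add: fun_bit_add_eq_0_iff)
    qed
    moreover have "x + a + b \<in> Z2n n" using x ab S by (auto intro!: Z2n_add)
    ultimately have "(\<Sum>z\<in>Z2n n. ?A x z * ?A z (x + a + b)) = 0"
      using U x by (auto simp: unitary_signing_def QS_def)
    then show "\<sigma> x (x + a) * \<sigma> (x + a) (x + a + b) = - (\<sigma> x (x + b) * \<sigma> (x + b) (x + a + b))"
      using sum_two_paths[OF S x ab, of \<sigma>] by (simp add: eq_neg_iff_add_eq_0)
  qed
  ultimately show "?C \<and> ?N" ..
next
  let ?A = "signed_adjacency (QS n S) \<sigma>"
  assume CN: "?C \<and> ?N"
  have "(\<Sum>z\<in>Z2n n. ?A x z * ?A z y) = (if x = y then of_nat (card S) else 0)"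
    if x: "x \<in> Z2n n" and y: "y \<in> Z2n n" for x y
  proof (cases "x = y")
    case True
    have "?A x z * ?A z x = (if (x, z) \<in> parcs (QS n S) then 1 else 0)" if "z \<in> Z2n n" for z
      using that x CN complex_signing_mult_swap[of "QS n S" \<sigma> x z]
      by (auto simp: signed_adjacency_def QS_def add.commute)
    then have "(\<Sum>z\<in>Z2n n. ?A x z * ?A z x) = (\<Sum>z\<in>Z2n n. if (x, z) \<in> parcs (QS n S) then 1 else 0)"
      by (intro sum.cong) auto
    also have "\<dots> = of_nat (card {z \<in> Z2n n. (x, z) \<in> parcs (QS n S)})"
      by (simp add: sum.If_cases finite_Z2n Int_def)
    also have "{z \<in> Z2n n. (x, z) \<in> parcs (QS n S)} = {z. (x, z) \<in> parcs (QS n S)}"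
      by (auto simp: QS_def)
    finally show ?thesis
      using True x regular_graph_QS[OF S(1)] by (simp add: regular_graph_def QS_def)
  next
    case False
    show ?thesis
    proof (cases "\<exists>z\<in>Z2n n. ?A x z * ?A z y \<noteq> 0")
      case True
      then obtain z where z: "x + z \<in> S" "z + y \<in> S"
        by (auto simp: signed_adjacency_def QS_def split: if_splits)
      \<comment> \<open>A common neighbour \<open>z\<close> exhibits \<open>y\<close> as
        \<open>x + a + b\<close> with \<open>a = x + z\<close> and \<open>b = z + y\<close> in
        \<open>S\<close>.\<close>
      have y_eq: "y = x + (x + z) + (z + y)"
        by (simp add: ac_simps)
      have ne: "x + z \<noteq> z + y" using False by (simp add: add.commute)
      have "\<sigma> x (x + (x + z)) * \<sigma> (x + (x + z)) (x + (x + z) + (z + y)) =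
          - (\<sigma> x (x + (z + y)) * \<sigma> (x + (z + y)) (x + (x + z) + (z + y)))"
        using CN x z ne by blast
      then show ?thesis
        using sum_two_paths[OF S x z ne, of \<sigma>] False by (simp only: flip: y_eq) simp
    qed (use False in \<open>auto intro: sum.neutral\<close>)
  qed
  then show ?U
    using CN regular_graph_QS[OF S(1)] unfolding unitary_signing_def
    by (auto simp: QS_def intro!: exI[of _ "card S"])
qed

section \<open>Sign products along walks\<close>

text \<open>A walk is encoded by its start and its list of steps, so that permuting the steps keeps
  both endpoints.\<close>

fun walk_product :: "('g::plus \<Rightarrow> 'g \<Rightarrow> complex) \<Rightarrow> 'g \<Rightarrow> 'g list \<Rightarrow> complex" where
  "walk_product \<sigma> x [] = 1"
| "walk_product \<sigma> x (s # w) = \<sigma> x (x + s) * walk_product \<sigma> (x + s) w"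

text \<open>Unitary signings for Sidon sets are instances by \<open>unitary_signing_QS_iff\<close>.
  Conjugate symmetry appears as \<open>swap_inverse\<close>, since conjugation inverts fourth roots
  of unity.\<close>

locale negative_signing =
  fixes n :: nat and S :: "(nat \<Rightarrow> bit) set" and \<sigma> :: "(nat \<Rightarrow> bit) \<Rightarrow> (nat \<Rightarrow> bit) \<Rightarrow> complex"
  assumes S_subset: "S \<subseteq> Z2n n"
    and swap_inverse: "x \<in> Z2n n \<Longrightarrow> s \<in> S \<Longrightarrow> \<sigma> x (x + s) * \<sigma> (x + s) x = 1"
    and four_cycle: "x \<in> Z2n n \<Longrightarrow> a \<in> S \<Longrightarrow> b \<in> S \<Longrightarrow> a \<noteq> b \<Longrightarrow>
      \<sigma> x (x + a) * \<sigma> (x + a) (x + a + b) = - (\<sigma> x (x + b) * \<sigma> (x + b) (x + a + b))"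
begin

lemma add_mem: "x \<in> Z2n n \<Longrightarrow> s \<in> S \<Longrightarrow> x + s \<in> Z2n n"
  using S_subset by (auto intro: Z2n_add)

lemma walk_product_append:
  "walk_product \<sigma> x (u @ v) = walk_product \<sigma> x u * walk_product \<sigma> (x + sum_list u) v"
  by (induction u arbitrary: x) (simp_all add: algebra_simps)

text \<open>The letter \<open>a\<close> moves to the end by adjacent swaps. Each swap with a
  different letter crosses one four-cycle and costs a sign; a swap with another \<open>a\<close>
  changes nothing.\<close>

lemma walk_product_Cons:
  assumes "x \<in> Z2n n" "a \<in> S" "set w \<subseteq> S"
  shows "walk_product \<sigma> x (a # w) =
    (-1) ^ length (filter (\<lambda>b. b \<noteq> a) w) * walk_product \<sigma> x (w @ [a])"
  using assms
proof (induction w arbitrary: x)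
  case (Cons b w)
  then have b: "b \<in> S" and xb: "x + b \<in> Z2n n" by (auto intro: add_mem)
  have IH: "walk_product \<sigma> (x + b) (a # w) =
      (-1) ^ length (filter (\<lambda>b. b \<noteq> a) w) * walk_product \<sigma> (x + b) (w @ [a])"
    using Cons xb by auto
  show ?case
  proof (cases "a = b")
    case True
    then show ?thesis using IH by simp
  next
    case False
    have "walk_product \<sigma> x (a # b # w) =
        (\<sigma> x (x + a) * \<sigma> (x + a) (x + a + b)) * walk_product \<sigma> (x + a + b) w"
      by simp
    also have "\<dots> = - (\<sigma> x (x + b) * walk_product \<sigma> (x + b) (a # w))"
      using four_cycle[of x a b] Cons.prems b False by (simp add: ac_simps)
    also note IH
    finally show ?thesis using False by simp
  qed
qed simp

text \<open>The letters of \<open>u\<close> are carried past \<open>v\<close> one at a time, so the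
  exponent counts pairs of unequal letters from \<open>u\<close> and \<open>v\<close>.\<close>

lemma walk_product_append_commute:
  assumes "x \<in> Z2n n" "set u \<subseteq> S" "set v \<subseteq> S"
  shows "walk_product \<sigma> x (u @ v) =
    (-1) ^ (\<Sum>a\<leftarrow>u. length (filter (\<lambda>b. b \<noteq> a) v)) * walk_product \<sigma> x (v @ u)"
  using assms
proof (induction u arbitrary: x v)
  case (Cons a u)
  let ?k = "length (filter (\<lambda>b. b \<noteq> a) v)" and ?m = "\<Sum>a\<leftarrow>u. length (filter (\<lambda>b. b \<noteq> a) v)"
  have a: "a \<in> S" and xa: "x + a \<in> Z2n n" using Cons.prems by (auto intro: add_mem)
  have "walk_product \<sigma> x ((a # u) @ v) = \<sigma> x (x + a) * walk_product \<sigma> (x + a) (u @ v)"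
    by simp
  also have "\<dots> = (-1) ^ ?m * walk_product \<sigma> x ((a # v) @ u)"
    using Cons xa by simp
  also have "walk_product \<sigma> x ((a # v) @ u) =
      walk_product \<sigma> x (a # v) * walk_product \<sigma> (x + sum_list (a # v)) u"
    by (rule walk_product_append)
  also have "walk_product \<sigma> x (a # v) = (-1) ^ ?k * walk_product \<sigma> x (v @ [a])"
    using Cons.prems a by (intro walk_product_Cons) auto
  also have "sum_list (a # v) = sum_list (v @ [a])" by (simp add: add.commute)
  also have "(-1) ^ ?k * walk_product \<sigma> x (v @ [a]) * walk_product \<sigma> (x + sum_list (v @ [a])) u
      = (-1) ^ ?k * walk_product \<sigma> x ((v @ [a]) @ u)"
    by (simp only: walk_product_append mult.assoc)
  finally show ?case by (simp add: power_add)
qed simp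

text \<open>Reversal swaps every pair of positions once, and distinctness makes each swap cost a
  sign.\<close>

lemma walk_product_rev:
  assumes "x \<in> Z2n n" "set w \<subseteq> S" "distinct w"
  shows "walk_product \<sigma> x (rev w) = (-1) ^ (length w choose 2) * walk_product \<sigma> x w"
  using assms
proof (induction w arbitrary: x)
  case (Cons a w)
  have a: "a \<in> S" and xa: "x + a \<in> Z2n n" using Cons.prems by (auto intro: add_mem)
  have "filter (\<lambda>b. b \<noteq> a) (rev w) = rev w"
    using Cons.prems by (auto simp: filter_id_conv)
  then have "walk_product \<sigma> x (a # rev w) = (-1) ^ length w * walk_product \<sigma> x (rev w @ [a])"
    using walk_product_Cons[of x a "rev w"] Cons.prems by simp
  moreover have "walk_product \<sigma> x (a # rev w) = (-1) ^ (length w choose 2) * walk_product \<sigma> x (a # w)"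
    using Cons xa by simp
  ultimately have "(-1) ^ length w * walk_product \<sigma> x (rev w @ [a]) =
      (-1) ^ (length w choose 2) * walk_product \<sigma> x (a # w)"
    by simp
  then have "(-1) ^ length w * ((-1) ^ length w * walk_product \<sigma> x (rev w @ [a])) =
      (-1) ^ length w * ((-1) ^ (length w choose 2) * walk_product \<sigma> x (a # w))"
    by simp
  then have "walk_product \<sigma> x (rev w @ [a]) =
      (-1) ^ (length w + (length w choose 2)) * walk_product \<sigma> x (a # w)"
    by (simp add: power_add flip: mult.assoc power_mult_distrib)
  then show ?case by (simp add: numeral_2_eq_2)
qed (simp add: numeral_2_eq_2)

text \<open>Steps are their own inverses, so the reversed word read from the endpoint retraces the
  walk and the edge values cancel in pairs.\<close>

lemma walk_product_rev_inverse:
  assumes "x \<in> Z2n n" "set w \<subseteq> S"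
  shows "walk_product \<sigma> x w * walk_product \<sigma> (x + sum_list w) (rev w) = 1"
  using assms
proof (induction w arbitrary: x)
  case (Cons a w)
  have xa: "x + a \<in> Z2n n" using Cons.prems by (auto intro: add_mem)
  have "walk_product \<sigma> x (a # w) * walk_product \<sigma> (x + sum_list (a # w)) (rev (a # w)) =
      (walk_product \<sigma> (x + a) w * walk_product \<sigma> (x + a + sum_list w) (rev w)) *
      (\<sigma> x (x + a) * \<sigma> (x + a) x)"
  proof -
    have "x + sum_list (a # w) + sum_list (rev w) = x + a" "x + a + a = x"
      by (auto simp: add.assoc sum_list_rev)
    then show ?thesis by (simp add: walk_product_append ac_simps)
  qed
  also have "\<dots> = 1"
    using Cons swap_inverse[of x a] xa by simp
  finally show ?case .
qed simp

lemma walk_product_real: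
  assumes "\<And>x s. x \<in> Z2n n \<Longrightarrow> s \<in> S \<Longrightarrow> \<sigma> x (x + s) \<in> {1, -1}"
    and "x \<in> Z2n n" "set w \<subseteq> S"
  shows "walk_product \<sigma> x w \<in> {1, -1}"
  using assms(2-)
proof (induction w arbitrary: x)
  case (Cons a w)
  then show ?case using assms(1)[of x a] add_mem[of x a] by fastforce
qed simp

lemma finite_S: "finite S"
  using S_subset finite_Z2n finite_subset by blast

lemma dependency_word:
  assumes "dependency_relation S D"
  obtains w where "set w = D" "distinct w" "length w = card D" "set w \<subseteq> S" "sum_list w = 0"
proof -
  have D: "D \<subseteq> S" "\<Sum>D = 0" "finite D"
    using assms finite_S finite_subset by (auto simp: dependency_relation_def)
  obtain w where "set w = D" "distinct w"
    using finite_distinct_list[OF D(3)] by blast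
  then show ?thesis
    using that D distinct_card[of w] sum_list_distinct_conv_sum_set[of w "\<lambda>x. x"] by auto
qed

text \<open>Words for \<open>D\<close> and \<open>E\<close> give closed walks at 0, whose nonzero
  values commute as complex numbers. Exchanging the words therefore costs no sign, and the exponent
  counts the pairs of unequal letters in the product of \<open>D\<close> and
  \<open>E\<close>.\<close>

lemma dependency_even_parity:
  assumes D: "dependency_relation S D" and E: "dependency_relation S E"
  shows "even (card D * card E + card (D \<inter> E))"
proof -
  obtain u where u: "set u = D" "distinct u" "set u \<subseteq> S" "sum_list u = 0"
    using dependency_word[OF D] by blast
  obtain v where v: "set v = E" "distinct v" "set v \<subseteq> S" "sum_list v = 0"
    using dependency_word[OF E] by blast
  let ?m = "\<Sum>a\<leftarrow>u. length (filter (\<lambda>b. b \<noteq> a) v)"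
  have 0: "(0 :: nat \<Rightarrow> bit) \<in> Z2n n" by (simp add: Z2n_def plus_fun_apply)
  have nz: "walk_product \<sigma> 0 w \<noteq> 0" if "set w \<subseteq> S" for w
    using walk_product_rev_inverse[OF 0 that] by auto
  have "walk_product \<sigma> 0 u * walk_product \<sigma> 0 v =
      (-1) ^ ?m * (walk_product \<sigma> 0 u * walk_product \<sigma> 0 v)"
    using walk_product_append_commute[OF 0 u(3) v(3)] u v
    by (simp add: walk_product_append mult.commute)
  then have "(-1 :: complex) ^ ?m = 1" using nz u v by simp
  then have m: "even ?m" by (rule even_if_minus_one_power_eq_1)
  have fin: "finite D" "finite E" using u v by auto
  have "length (filter (\<lambda>b. b \<noteq> a) v) = card (E - {a})" for a
    using v distinct_card[of "filter (\<lambda>b. b \<noteq> a) v"] by (simp add: set_diff_eq)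
  then have m_eq: "?m = (\<Sum>a\<in>D. card (E - {a}))"
    using u by (simp add: sum_list_distinct_conv_sum_set)
  have "card (E - {a}) + of_bool (a \<in> E) = card E" for a
    using fin(2) card_Suc_Diff1[of E a] by auto
  then have "(\<Sum>a\<in>D. card (E - {a})) + (\<Sum>a\<in>D. of_bool (a \<in> E)) = card D * card E"
    by (simp flip: sum.distrib)
  moreover have "(\<Sum>a\<in>D. of_bool (a \<in> E)) = card (D \<inter> E)"
    using fin by (simp add: Int_def)
  ultimately have "?m + card (D \<inter> E) = card D * card E" using m_eq by simp
  then show ?thesis using m by (metis even_add)
qed

lemma dependency_real_card:
  assumes real: "\<And>x s. x \<in> Z2n n \<Longrightarrow> s \<in> S \<Longrightarrow> \<sigma> x (x + s) \<in> {1, -1}"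
    and D: "dependency_relation S D"
  shows "card D mod 4 \<in> {0, 1}"
proof -
  obtain w where w: "distinct w" "length w = card D" "set w \<subseteq> S" "sum_list w = 0"
    using dependency_word[OF D] by blast
  have 0: "(0 :: nat \<Rightarrow> bit) \<in> Z2n n" by (simp add: Z2n_def plus_fun_apply)
  let ?p = "walk_product \<sigma> 0 w"
  \<comment> \<open>The walk is closed, so its reversal also starts at 0 and the inverse and
    reversal formulas concern the same product.\<close>
  have "?p * ((-1) ^ (card D choose 2) * ?p) = 1"
    using walk_product_rev_inverse[OF 0 w(3)] walk_product_rev[OF 0 w(3) w(1)] w by simp
  moreover have "?p * ?p = 1"
    using walk_product_real[OF real 0 w(3)] by auto
  ultimately have "(-1 :: complex) ^ (card D choose 2) = 1"
    by (metis mult.left_commute mult.right_neutral)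
  then have "even (card D choose 2)" by (rule even_if_minus_one_power_eq_1)
  then show ?thesis by (simp only: even_choose_two_iff)
qed

end

section \<open>Dependency relations and the Theta-property\<close>

text \<open>The triple \<open>D \<inter> E\<close>, \<open>D - E\<close>, \<open>E - D\<close>
  corresponds to the pair \<open>A \<union> B\<close>, \<open>A \<union> C\<close>. For sizes p, q,
  r of the triple the parity is that of (p+q)(p+r)+p, hence of pq+pr+qr, which is even iff at least
  two of them are even.\<close>

lemma theta_property_iff:
  fixes S :: "('a \<Rightarrow> bit) set"
  assumes "finite S"
  shows "theta_property S \<longleftrightarrow> (\<forall>D E. dependency_relation S D \<longrightarrow> dependency_relation S E \<longrightarrow>
    even (card D * card E + card (D \<inter> E)))"
proof
  assume \<Theta>: "theta_property S"
  show "\<forall>D E. dependency_relation S D \<longrightarrow> dependency_relation S E \<longrightarrow>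
    even (card D * card E + card (D \<inter> E))"
  proof (intro allI impI)
    fix D E assume D: "dependency_relation S D" and E: "dependency_relation S E"
    have fin: "finite D" "finite E"
      using D E assms finite_subset by (auto simp: dependency_relation_def)
    have s: "\<Sum>D = \<Sum>(D \<inter> E) + \<Sum>(D - E)" "\<Sum>E = \<Sum>(D \<inter> E) + \<Sum>(E - D)"
      using sum.Int_Diff[OF fin(1), of "\<lambda>x. x" E] sum.Int_Diff[OF fin(2), of "\<lambda>x. x" D]
      by (simp_all add: Int_commute)
    have eq: "\<Sum>(D \<inter> E) = \<Sum>(D - E)" "\<Sum>(D - E) = \<Sum>(E - D)"
      using s D E by (auto simp: dependency_relation_def fun_bit_add_eq_0_iff)
    have c: "card D = card (D \<inter> E) + card (D - E)" "card E = card (D \<inter> E) + card (E - D)"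
      using card_Int_Diff[OF fin(1), of E] card_Int_Diff[OF fin(2), of D]
      by (simp_all add: Int_commute)
    have "D \<inter> E \<subseteq> S" "D - E \<subseteq> S" "E - D \<subseteq> S"
      using D E by (auto simp: dependency_relation_def)
    moreover have "(D \<inter> E) \<inter> (D - E) = {}" "(D \<inter> E) \<inter> (E - D) = {}" "(D - E) \<inter> (E - D) = {}"
      by auto
    ultimately have "even (card (D \<inter> E)) \<and> even (card (D - E)) \<or>
        even (card (D \<inter> E)) \<and> even (card (E - D)) \<or> even (card (D - E)) \<and> even (card (E - D))"
      using \<Theta> eq unfolding theta_property_def by blast
    then show "even (card D * card E + card (D \<inter> E))"
      unfolding c by auto
  qed
next
  assume *: "\<forall>D E. dependency_relation S D \<longrightarrow> dependency_relation S E \<longrightarrow>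
    even (card D * card E + card (D \<inter> E))"
  show "theta_property S"
    unfolding theta_property_def
  proof (intro allI impI, elim conjE)
    fix A B C assume sub: "A \<subseteq> S" "B \<subseteq> S" "C \<subseteq> S"
      and disj: "A \<inter> B = {}" "A \<inter> C = {}" "B \<inter> C = {}"
      and eq: "\<Sum>A = \<Sum>B" "\<Sum>B = \<Sum>C"
    have fin: "finite A" "finite B" "finite C"
      using sub assms by (auto intro: finite_subset)
    have "dependency_relation S (A \<union> B)" "dependency_relation S (A \<union> C)"
      using sub disj eq fin by (auto simp: dependency_relation_def sum.union_disjoint)
    then have "even (card (A \<union> B) * card (A \<union> C) + card ((A \<union> B) \<inter> (A \<union> C)))"
      using * by blast
    moreover have "(A \<union> B) \<inter> (A \<union> C) = A" using disj by auto
    ultimately show "even (card A) \<and> even (card B) \<or> even (card A) \<and> even (card C) \<or>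
        even (card B) \<and> even (card C)"
      using fin disj by (auto simp: card_Un_disjoint)
  qed
qed

text \<open>Since disjoint dependency relations have sizes whose product is even, sizes congruent to
  \<open>0\<close> or \<open>1\<close> modulo \<open>4\<close> are preserved when a minimal relation is split off.\<close>

lemma dependency_card_of_minimal:
  fixes S :: "('a \<Rightarrow> bit) set"
  assumes fin: "finite S" and \<Theta>: "theta_property S"
    and min: "\<not> (\<exists>D. minimal_dependency_relation S D \<and> card D mod 4 \<in> {2, 3})"
    and D: "dependency_relation S D"
  shows "card D mod 4 \<in> {0, 1}"
proof -
  have "finite D" using D fin finite_subset by (auto simp: dependency_relation_def)
  then show ?thesis using D
  proof (induction D rule: finite_psubset_induct)
    case (psubset D)
    show ?case
    proof (cases "D = {} \<or> minimal_dependency_relation S D")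
      case True
      moreover have "card D mod 4 < 4" by simp
      ultimately show ?thesis using min by fastforce
    next
      case False
      then obtain E where E: "E \<subset> D" "E \<noteq> {}" "dependency_relation S E"
        using psubset.prems by (auto simp: minimal_dependency_relation_def)
      have finE: "finite E" using E psubset.hyps finite_subset by blast
      have "\<Sum>D = \<Sum>E + \<Sum>(D - E)"
        using sum.subset_diff[of E D "\<lambda>x. x"] E psubset.hyps by (simp add: add.commute)
      then have F: "dependency_relation S (D - E)"
        using psubset.prems E by (auto simp: dependency_relation_def)
      have "D - E \<subset> D" using E by blast
      then have IH: "card E mod 4 \<in> {0, 1}" "card (D - E) mod 4 \<in> {0, 1}"
        using psubset.IH E F by blast+
      \<comment> \<open>This rules out two odd sizes, the only case in which residues 0 and 1 could
        add up to 2.\<close>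
      have "even (card E * card (D - E) + card (E \<inter> (D - E)))"
        using \<Theta> E(3) F theta_property_iff[OF fin] by blast
      then have "even (card E) \<or> even (card (D - E))" by simp
      moreover have "card D = card E + card (D - E)"
        using E(1) psubset.hyps finE card_Diff_subset[of E D] card_mono[of D E] by auto
      ultimately show ?thesis using IH mod_4_add by metis
    qed
  qed
qed

section \<open>The Clifford cocycle\<close>

text \<open>\<open>(-1) ^ clifford_form S r u v\<close> is the sign from sorting, by \<open>r\<close>, the product of the sorted
  Clifford monomials of \<open>u\<close> and \<open>v\<close>.\<close>

definition clifford_form :: "'a set \<Rightarrow> ('a \<Rightarrow> nat) \<Rightarrow> ('a \<Rightarrow> bit) \<Rightarrow> ('a \<Rightarrow> bit) \<Rightarrow> bit" where
  "clifford_form S r u v = (\<Sum>a\<in>S. \<Sum>b\<in>S. if r b < r a then u a * v b else 0)"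

definition indicator_vec :: "'a set \<Rightarrow> 'a \<Rightarrow> bit" where
  "indicator_vec D a = (if a \<in> D then 1 else 0)"

text \<open>On coefficient vectors supported on \<open>S\<close>, the kernel of this linear map
  consists of the indicator vectors of dependency relations.\<close>

definition lin_comb :: "('i \<Rightarrow> bit) set \<Rightarrow> (('i \<Rightarrow> bit) \<Rightarrow> bit) \<Rightarrow> 'i \<Rightarrow> bit" where
  "lin_comb S v i = (\<Sum>a\<in>S. v a * a i)"

lemma clifford_form_add_left:
  "clifford_form S r (u + v) w = clifford_form S r u w + clifford_form S r v w"
  unfolding clifford_form_def sum.distrib[symmetric]
  by (intro sum.cong) (auto simp: plus_fun_apply algebra_simps)

lemma clifford_form_add_right:
  "clifford_form S r w (u + v) = clifford_form S r w u + clifford_form S r w v"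
  unfolding clifford_form_def sum.distrib[symmetric]
  by (intro sum.cong) (auto simp: plus_fun_apply algebra_simps)

text \<open>As \<open>r\<close> is injective, the two forms together cover each ordered pair of
  distinct elements once. Adding the diagonal completes the sum to a product, and the diagonal is
  subtracted again in characteristic two. On indicator vectors this is the parity from
  \<open>theta_property_iff\<close>.\<close>

lemma clifford_form_commutator:
  assumes "finite S" "inj_on r S"
  shows "clifford_form S r u v + clifford_form S r v u =
    (\<Sum>a\<in>S. u a) * (\<Sum>a\<in>S. v a) + (\<Sum>a\<in>S. u a * v a)"
proof -
  have "clifford_form S r v u = (\<Sum>a\<in>S. \<Sum>b\<in>S. if r a < r b then u a * v b else 0)"
    unfolding clifford_form_def by (subst sum.swap) (simp only: mult.commute)
  then have "clifford_form S r u v + clifford_form S r v u =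
      (\<Sum>a\<in>S. \<Sum>b\<in>S. u a * v b + (if b = a then u a * v b else 0))"
    unfolding clifford_form_def using inj_onD[OF assms(2)]
    by (auto simp flip: sum.distrib intro!: sum.cong simp: neq_iff)
  also have "\<dots> = (\<Sum>a\<in>S. \<Sum>b\<in>S. u a * v b) + (\<Sum>a\<in>S. u a * v a)"
    using assms(1) by (simp add: sum.distrib)
  finally show ?thesis by (simp add: sum_product)
qed

lemma clifford_form_singleton: "clifford_form S r (indicator_vec {a}) (indicator_vec {a}) = 0"
  unfolding clifford_form_def by (intro sum.neutral ballI) (auto simp: indicator_vec_def)

lemma sum_indicator_vec:
  assumes "finite S" "D \<subseteq> S"
  shows "(\<Sum>a\<in>S. indicator_vec D a) = of_nat (card D)"
  using assms by (simp add: indicator_vec_def sum.If_cases Int_absorb1 finite_subset)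

lemma clifford_form_commutator_indicator:
  assumes "finite S" "inj_on r S" "D \<subseteq> S" "E \<subseteq> S"
  shows "clifford_form S r (indicator_vec D) (indicator_vec E) +
    clifford_form S r (indicator_vec E) (indicator_vec D) = of_nat (card D * card E + card (D \<inter> E))"
proof -
  have "indicator_vec D a * indicator_vec E a = indicator_vec (D \<inter> E) a" for a
    by (simp add: indicator_vec_def)
  moreover have "D \<inter> E \<subseteq> S" using assms by auto
  ultimately show ?thesis
    using assms by (simp add: clifford_form_commutator sum_indicator_vec)
qed

lemma clifford_form_indicator_self:
  assumes "finite S" "inj_on r S" "D \<subseteq> S"
  shows "clifford_form S r (indicator_vec D) (indicator_vec D) = of_nat (card D choose 2)"
proof -
  have "finite D" using assms finite_subset by blast
  then show ?thesis using assms(3)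
  proof (induction D)
    case empty
    have "indicator_vec {} a = 0" for a :: 'a by (simp add: indicator_vec_def)
    then show ?case by (simp add: clifford_form_def numeral_2_eq_2 cong: if_cong)
  next
    case (insert x D)
    have eq: "indicator_vec (insert x D) = indicator_vec {x} + indicator_vec D"
      using insert by (auto simp: indicator_vec_def fun_eq_iff plus_fun_apply)
    have "clifford_form S r (indicator_vec (insert x D)) (indicator_vec (insert x D)) =
        clifford_form S r (indicator_vec D) (indicator_vec D) +
        (clifford_form S r (indicator_vec {x}) (indicator_vec D) +
         clifford_form S r (indicator_vec D) (indicator_vec {x}))"
      \<comment> \<open>Only the two cross terms are new, and their sum is a commutator, which does
        not depend on where \<open>x\<close> stands in the order.\<close>
      unfolding eq
      by (simp add: clifford_form_add_left clifford_form_add_right clifford_form_singleton ac_simps)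
    also have "\<dots> = of_nat (card D choose 2) + of_nat (card D)"
      using insert clifford_form_commutator_indicator[OF assms(1,2), of "{x}" D] by simp
    finally show ?case using insert by (simp add: numeral_2_eq_2)
  qed
qed

lemma lin_comb_add: "lin_comb S (u + v) = lin_comb S u + lin_comb S v"
  by (simp add: lin_comb_def fun_eq_iff plus_fun_apply distrib_right sum.distrib)

lemma lin_comb_indicator:
  assumes "finite S" "D \<subseteq> S"
  shows "lin_comb S (indicator_vec D) = \<Sum>D"
proof
  fix i
  have "lin_comb S (indicator_vec D) i = (\<Sum>a\<in>S. if a \<in> D then a i else 0)"
    unfolding lin_comb_def by (intro sum.cong) (auto simp: indicator_vec_def)
  also have "\<dots> = (\<Sum>a\<in>D. a i)"
    using assms by (simp add: sum.If_cases Int_absorb1)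
  also have "\<dots> = (\<Sum>D) i"
    by (induction D rule: infinite_finite_induct) (simp_all add: plus_fun_apply)
  finally show "lin_comb S (indicator_vec D) i = (\<Sum>D) i" .
qed

lemma group_closure_lin_comb:
  assumes "finite S" "x \<in> group_closure S"
  obtains u where "lin_comb S u = x" "\<And>a. a \<notin> S \<Longrightarrow> u a = 0"
proof -
  have "\<exists>u. lin_comb S u = x \<and> (\<forall>a. a \<notin> S \<longrightarrow> u a = 0)"
    using assms(2)
  proof induction
    case (base s)
    show ?case
    proof (cases "s \<in> S")
      case True
      then show ?thesis
        using lin_comb_indicator[OF assms(1), of "{s}"]
        by (intro exI[of _ "indicator_vec {s}"] conjI) (simp, auto simp: indicator_vec_def)
    next
      case False
      \<comment> \<open>The base rule also produces 0, which the zero vector represents.\<close>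
      then show ?thesis using base
        by (intro exI[of _ 0]) (auto simp: lin_comb_def fun_eq_iff)
    qed
  next
    case (diff s t)
    then obtain u v where uv: "lin_comb S u = s" "\<forall>a. a \<notin> S \<longrightarrow> u a = 0"
      "lin_comb S v = t" "\<forall>a. a \<notin> S \<longrightarrow> v a = 0" by blast
    have "s - t = s + t" by (simp add: fun_eq_iff plus_fun_apply)
    then have "lin_comb S (u + v) = s - t" using uv by (simp add: lin_comb_add)
    moreover have "\<forall>a. a \<notin> S \<longrightarrow> (u + v) a = 0" using uv by (simp add: plus_fun_apply)
    ultimately show ?case by blast
  qed
  then show ?thesis using that by blast
qed

text \<open>A central extension by \<open>\<plusminus>1\<close> with commutative total space splits after enlarging
  \<open>\<plusminus>1\<close> by square roots of the values \<open>\<beta> x x\<close>: extend a splitting from a maximal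
  subgroup by one more element.\<close>

lemma cocycle_splits:
  fixes \<beta> :: "'g::ab_group_add \<Rightarrow> 'g \<Rightarrow> bit" and K :: "'g set" and U :: "complex set"
  assumes fin: "finite K" and K0: "0 \<in> K" and K_add: "\<And>x y. x \<in> K \<Longrightarrow> y \<in> K \<Longrightarrow> x + y \<in> K"
    and two: "\<And>x. x \<in> K \<Longrightarrow> x + x = 0"
    and add_left: "\<And>x y z. \<beta> (x + y) z = \<beta> x z + \<beta> y z"
    and add_right: "\<And>x y z. \<beta> z (x + y) = \<beta> z x + \<beta> z y"
    and sym: "\<And>x y. x \<in> K \<Longrightarrow> y \<in> K \<Longrightarrow> \<beta> x y = \<beta> y x"
    and U: "1 \<in> U" "-1 \<in> U" "\<And>a b. a \<in> U \<Longrightarrow> b \<in> U \<Longrightarrow> a * b \<in> U"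
    and roots: "\<And>x. x \<in> K \<Longrightarrow> \<exists>c\<in>U. c * c = bit_sign (\<beta> x x)"
  obtains f where "f 0 = 1" "\<And>x. x \<in> K \<Longrightarrow> f x \<in> U"
    "\<And>x y. x \<in> K \<Longrightarrow> y \<in> K \<Longrightarrow> f (x + y) = bit_sign (\<beta> x y) * f x * f y"
proof -
  \<comment> \<open>\<open>good H f\<close> is a splitting over the subgroup \<open>H\<close>;
    finiteness of \<open>K\<close> then gives a maximal such \<open>H\<close>.\<close>
  define good where "good H f \<longleftrightarrow> 0 \<in> H \<and> (\<forall>x\<in>H. \<forall>y\<in>H. x + y \<in> H) \<and> f 0 = 1 \<and>
    (\<forall>x\<in>H. f x \<in> U) \<and> (\<forall>x\<in>H. \<forall>y\<in>H. f (x + y) = bit_sign (\<beta> x y) * f x * f y)"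
    for H :: "'g set" and f :: "'g \<Rightarrow> complex"
  define \<H> where "\<H> = {H. H \<subseteq> K \<and> (\<exists>f. good H f)}"
  have "\<beta> 0 0 = 0" using add_left[of 0 0 0] by simp
  then have "good {0} (\<lambda>_. 1)"
    using U by (simp add: good_def)
  then have "{0} \<in> \<H>" using K0 by (auto simp: \<H>_def)
  moreover have "finite \<H>"
    using fin by (intro finite_subset[of \<H> "Pow K"]) (auto simp: \<H>_def)
  ultimately obtain H where H: "H \<in> \<H>" and max: "\<And>H'. H' \<in> \<H> \<Longrightarrow> H \<subseteq> H' \<Longrightarrow> H = H'"
    using finite_has_maximal[of \<H>] by blast
  obtain f where HK: "H \<subseteq> K" and f: "good H f" using H by (auto simp: \<H>_def)
  have H0: "0 \<in> H" and Hadd: "\<And>x y. x \<in> H \<Longrightarrow> y \<in> H \<Longrightarrow> x + y \<in> H" and f0: "f 0 = 1"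
    and fU: "\<And>x. x \<in> H \<Longrightarrow> f x \<in> U"
    and fadd: "\<And>x y. x \<in> H \<Longrightarrow> y \<in> H \<Longrightarrow> f (x + y) = bit_sign (\<beta> x y) * f x * f y"
    using f by (auto simp: good_def)
  have "H = K"
  proof (rule ccontr)
    assume "H \<noteq> K"
    then obtain d where d: "d \<in> K" "d \<notin> H" using HK by blast
    \<comment> \<open>The law at \<open>d + d = 0\<close> forces the square of the value at
      \<open>d\<close>, so \<open>c\<close> has to be such a root.\<close>
    obtain c where c: "c \<in> U" "c * c = bit_sign (\<beta> d d)" using roots[OF d(1)] by blast
    define H' where "H' = H \<union> (\<lambda>x. x + d) ` H"
    \<comment> \<open>On the coset of \<open>d\<close>, the law applied to
      \<open>x = (x + d) + d\<close> forces this value once \<open>d\<close> is sent to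
      \<open>c\<close>.\<close>
    define g where "g x = (if x \<in> H then f x else f (x + d) * bit_sign (\<beta> (x + d) d) * c)" for x
    have dd: "d + d = 0" using two d by simp
    have dd': "d + (d + x) = x" for x by (simp add: dd flip: add.assoc)
    have xd: "x + d \<notin> H" if "x \<in> H" for x
    proof
      assume "x + d \<in> H"
      then have "x + (x + d) \<in> H" using that Hadd by blast
      moreover have "x + (x + d) = d" using two[of x] that HK by (auto simp flip: add.assoc)
      ultimately show False using d by simp
    qed
    have g1: "g x = f x" and g2: "g (x + d) = f x * bit_sign (\<beta> x d) * c" if "x \<in> H" for x
      using that xd[OF that] by (simp_all add: g_def add.assoc dd)
    have H'cases: "x \<in> H' \<Longrightarrow> x \<in> H \<or> (\<exists>y\<in>H. x = y + d)" for x by (auto simp: H'_def)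
    have bU: "bit_sign b \<in> U" for b using U by (cases b) simp_all
    have symd: "\<beta> d x = \<beta> x d" if "x \<in> H" for x using sym that d HK by blast
    have add1: "x + d + y = x + y + d" and add2: "x + (y + d) = x + y + d"
      and add3: "x + d + (y + d) = x + y" for x y
      using dd' by (simp_all add: ac_simps)
    have "x + y \<in> H' \<and> g (x + y) = bit_sign (\<beta> x y) * g x * g y" if "x \<in> H'" "y \<in> H'" for x y
    proof -
      have *: ?thesis if "x = x'" "y = y'" "x' \<in> H" "y' \<in> H" for x' y'
        using that Hadd fadd by (auto simp: g1 H'_def)
      have **: ?thesis if "x = x' + d" "y = y'" "x' \<in> H" "y' \<in> H" for x' y'
        using that Hadd[of x' y'] fadd[of x' y']
        by (auto simp: g1 g2 H'_def add1 add_left bit_sign_add symd)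
      have ***: ?thesis if "x = x'" "y = y' + d" "x' \<in> H" "y' \<in> H" for x' y'
        using that Hadd[of x' y'] fadd[of x' y']
        by (auto simp: g1 g2 H'_def add2 add_left add_right bit_sign_add symd)
      \<comment> \<open>For two elements of the coset the sum lies in \<open>H\<close>: the mixed
        signs occur twice, and \<open>c * c\<close> cancels the sign of
        \<open>\<beta> d d\<close>.\<close>
      have ****: ?thesis if xy: "x = x' + d" "y = y' + d" "x' \<in> H" "y' \<in> H" for x' y'
      proof -
        have "bit_sign (\<beta> x y) * g x * g y = bit_sign (\<beta> x' y') *
            (bit_sign (\<beta> x' d) * bit_sign (\<beta> x' d)) * (bit_sign (\<beta> y' d) * bit_sign (\<beta> y' d)) *
            (bit_sign (\<beta> d d) * (c * c)) * f x' * f y'"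
          using xy by (simp add: g2 add_left add_right bit_sign_add symd)
        also have "\<dots> = bit_sign (\<beta> x' y') * f x' * f y'"
          unfolding c(2) bit_sign_add[symmetric] by simp
        also have "\<dots> = g (x + y)" using xy Hadd fadd by (simp add: add3 g1)
        finally show ?thesis using xy Hadd by (simp add: add3 H'_def)
      qed
      show ?thesis using H'cases[OF that(1)] H'cases[OF that(2)] * ** *** **** by blast
    qed
    moreover have "g x \<in> U" if "x \<in> H'" for x
      using H'cases[OF that] fU c U(3) bU by (auto simp: g1 g2)
    moreover have "g 0 = 1" using g1[OF H0] f0 by simp
    ultimately have "good H' g"
      using H0 by (auto simp: good_def H'_def)
    moreover have "H' \<subseteq> K" using HK d K_add by (auto simp: H'_def)
    ultimately have "H' \<in> \<H>" by (auto simp: \<H>_def)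
    then have "H = H'" by (rule max) (auto simp: H'_def)
    moreover have "0 + d \<in> H'" using H0 by (auto simp: H'_def)
    ultimately show False using d by simp
  qed
  then show ?thesis using that f0 fU fadd by blast
qed

section \<open>Existence of signings\<close>

text \<open>With \<open>e\<^sub>v\<close> the Clifford monomial of \<open>v\<close>, the sign of the edge from \<open>x\<close> to \<open>x + s\<close> is the
  value of a character extending \<open>-1 \<mapsto> -1\<close> at \<open>e\<^sub>u e\<^sub>s e\<^sub>v\<^sup>-\<^sup>1\<close>, where \<open>u\<close> and \<open>v\<close> represent
  \<open>x\<close> and \<open>x + s\<close>.\<close>

lemma signing_exists:
  fixes S :: "(nat \<Rightarrow> bit) set" and U :: "complex set"
  assumes S: "S \<subseteq> Z2n n" "sidon S" and gen: "group_closure S = Z2n n"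
    and \<Theta>: "theta_property S"
    and U: "1 \<in> U" "-1 \<in> U" "\<And>a b. a \<in> U \<Longrightarrow> b \<in> U \<Longrightarrow> a * b \<in> U" "U \<subseteq> {1, -1, \<i>, -\<i>}"
    and roots: "\<And>D. dependency_relation S D \<Longrightarrow> \<exists>c\<in>U. c * c = bit_sign (of_nat (card D choose 2))"
  obtains \<sigma> where "unitary_signing (QS n S) \<sigma>" "\<forall>(x, y)\<in>parcs (QS n S). \<sigma> x y \<in> U"
proof -
  have fin: "finite S" using S finite_Z2n finite_subset by blast
  obtain r :: "(nat \<Rightarrow> bit) \<Rightarrow> nat" where r: "inj_on r S"
    using fin finite_imp_inj_to_nat_seg by metis
  define \<beta> where "\<beta> = clifford_form S r"
  define K where "K = {v. (\<forall>a. a \<notin> S \<longrightarrow> v a = 0) \<and> lin_comb S v = 0}"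
  define e where "e s = indicator_vec {s}" for s :: "nat \<Rightarrow> bit"
  have add_left: "\<beta> (u + v) w = \<beta> u w + \<beta> v w" and add_right: "\<beta> w (u + v) = \<beta> w u + \<beta> w v" for u v w
    by (simp_all add: \<beta>_def clifford_form_add_left clifford_form_add_right)
  have K_ind: "\<exists>D. dependency_relation S D \<and> v = indicator_vec D" if v: "v \<in> K" for v
  proof (intro exI conjI)
    show eq: "v = indicator_vec {a. v a = 1}"
      by (auto simp: indicator_vec_def fun_eq_iff plus_fun_apply)
    have sub: "{a. v a = 1} \<subseteq> S" using v by (force simp: K_def)
    have "\<Sum>{a. v a = 1} = lin_comb S v"
      using lin_comb_indicator[OF fin sub] eq by metis
    then show "dependency_relation S {a. v a = 1}"
      using v sub by (simp add: K_def dependency_relation_def)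
  qed
  have K_fin: "finite K"
    by (rule finite_subset[of _ "indicator_vec ` Pow S"])
      (use K_ind fin in \<open>auto simp: dependency_relation_def\<close>)
  have K_add: "u + v \<in> K" if "u \<in> K" "v \<in> K" for u v
    using that by (simp add: K_def lin_comb_add plus_fun_apply)
  have K0: "0 \<in> K" by (simp add: K_def lin_comb_def fun_eq_iff)
  \<comment> \<open>Here the Theta-property enters: it makes the monomials over \<open>K\<close>
    commute.\<close>
  have sym: "\<beta> u v = \<beta> v u" if "u \<in> K" "v \<in> K" for u v
  proof -
    obtain D E where DE: "dependency_relation S D" "u = indicator_vec D"
      "dependency_relation S E" "v = indicator_vec E"
      using K_ind \<open>u \<in> K\<close> \<open>v \<in> K\<close> by metis
    have "even (card D * card E + card (D \<inter> E))"
      using \<Theta> DE theta_property_iff[OF fin] by blast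
    then have "(of_nat (card D * card E + card (D \<inter> E)) :: bit) = 0"
      by (metis even_of_nat bit_not_zero_iff odd_one)
    then have "\<beta> u v + \<beta> v u = 0"
      using clifford_form_commutator_indicator[OF fin r, of D E] DE
      by (simp add: \<beta>_def dependency_relation_def)
    then show ?thesis by (simp add: bit_add_eq_0_iff)
  qed
  have roots': "\<exists>c\<in>U. c * c = bit_sign (\<beta> v v)" if "v \<in> K" for v
    using K_ind[OF that] roots clifford_form_indicator_self[OF fin r]
    by (auto simp: \<beta>_def dependency_relation_def)
  obtain f where f0: "f 0 = 1" and fU: "\<And>v. v \<in> K \<Longrightarrow> f v \<in> U"
    and fadd: "\<And>u v. u \<in> K \<Longrightarrow> v \<in> K \<Longrightarrow> f (u + v) = bit_sign (\<beta> u v) * f u * f v"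
    using cocycle_splits[of K \<beta> U, OF K_fin K0 K_add fun_bit_add_self add_left add_right sym U(1-3) roots']
    by blast
  have fsq: "f v * f v = bit_sign (\<beta> v v)" if "v \<in> K" for v
  proof -
    have "bit_sign (\<beta> v v) * (f v * f v) = 1"
      using fadd[OF that that] f0 by (simp add: mult.assoc)
    then show ?thesis using bit_sign_cases[of "\<beta> v v"] by (auto simp: minus_equation_iff)
  qed
  \<comment> \<open>Generation is used here: \<open>W\<close> picks for each vertex a representation
    as a combination of \<open>S\<close>.\<close>
  have "\<forall>x\<in>Z2n n. \<exists>u. lin_comb S u = x \<and> (\<forall>a. a \<notin> S \<longrightarrow> u a = 0)"
    using group_closure_lin_comb[OF fin] gen by metis
  then obtain W where W: "\<And>x. x \<in> Z2n n \<Longrightarrow> lin_comb S (W x) = x"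
    "\<And>x a. x \<in> Z2n n \<Longrightarrow> a \<notin> S \<Longrightarrow> W x a = 0" by metis
  \<comment> \<open>The first two terms are the signs from multiplying the monomials of
    \<open>u\<close>, \<open>s\<close> and \<open>v\<close> in turn; \<open>\<beta> v v\<close>
    turns the last monomial into its inverse. The vector \<open>u + s + v\<close> lies in
    \<open>K\<close> along edges.\<close>
  define \<sigma> where "\<sigma> x y = (let u = W x; s = e (x + y); v = W y in
    bit_sign (\<beta> u s + \<beta> (u + s) v + \<beta> v v) * f (u + s + v))" for x y
  have lin_e: "lin_comb S (e s) = s" if "s \<in> S" for s
    using lin_comb_indicator[OF fin, of "{s}"] that by (simp add: e_def)
  have K_edge: "W x + e (x + y) + W y \<in> K" if "x \<in> Z2n n" "y \<in> Z2n n" "x + y \<in> S" for x y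
  proof -
    have "lin_comb S (W x + e (x + y) + W y) = 0"
      using that by (simp add: lin_comb_add lin_e W ac_simps)
    moreover have "(W x + e (x + y) + W y) a = 0" if "a \<notin> S" for a
      using that W \<open>x \<in> Z2n n\<close> \<open>y \<in> Z2n n\<close> \<open>x + y \<in> S\<close>
      by (auto simp: plus_fun_apply e_def indicator_vec_def)
    ultimately show ?thesis by (simp add: K_def)
  qed
  have bU: "bit_sign b \<in> U" for b using U by (cases b) simp_all
  have \<sigma>_U: "\<sigma> x y \<in> U" if "x \<in> Z2n n" "y \<in> Z2n n" "x + y \<in> S" for x y
    using K_edge[OF that] fU bU U(3) by (simp add: \<sigma>_def Let_def)
  have \<beta>_e: "\<beta> (e s) (e s) = 0" for s by (simp add: \<beta>_def e_def clifford_form_singleton)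
  have inv: "\<sigma> x y * \<sigma> y x = 1" if xy: "x \<in> Z2n n" "y \<in> Z2n n" "x + y \<in> S" for x y
  proof -
    define u s v where "u = W x" and "s = e (x + y)" and "v = W y"
    have s': "e (y + x) = s" by (simp add: s_def add.commute)
    have "f (v + s + u) = f (u + s + v)" by (simp add: ac_simps)
    then have "\<sigma> x y * \<sigma> y x = bit_sign (\<beta> u s + \<beta> (u + s) v + \<beta> v v) *
        bit_sign (\<beta> v s + \<beta> (v + s) u + \<beta> u u) * (f (u + s + v) * f (u + s + v))"
      by (simp add: \<sigma>_def Let_def s' flip: u_def v_def s_def)
    also have "f (u + s + v) * f (u + s + v) = bit_sign (\<beta> (u + s + v) (u + s + v))"
      using fsq K_edge[OF xy] by (simp add: u_def s_def v_def)
    \<comment> \<open>By bilinearity everything except \<open>\<beta> s s\<close> occurs twice; that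
      term vanishes because a generator squares to 1.\<close>
    also have "bit_sign (\<beta> u s + \<beta> (u + s) v + \<beta> v v) * bit_sign (\<beta> v s + \<beta> (v + s) u + \<beta> u u) *
        bit_sign (\<beta> (u + s + v) (u + s + v)) = bit_sign (\<beta> s s)"
      unfolding bit_sign_add[symmetric] by (simp add: add_left add_right ac_simps)
    finally show ?thesis by (simp add: s_def \<beta>_e)
  qed
  have C: "complex_signing (QS n S) \<sigma>"
    unfolding complex_signing_def
  proof clarify
    fix x y assume "(x, y) \<in> parcs (QS n S)"
    then have xy: "x \<in> Z2n n" "y \<in> Z2n n" "x + y \<in> S" by (auto simp: QS_def)
    have 1: "\<sigma> x y \<in> {1, -1, \<i>, -\<i>}" using \<sigma>_U[OF xy] U(4) by blast
    then have "\<sigma> x y * cnj (\<sigma> x y) = 1" by auto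
    with inv[OF xy] have "\<sigma> x y * \<sigma> y x = \<sigma> x y * cnj (\<sigma> x y)" by simp
    then have "\<sigma> y x = cnj (\<sigma> x y)" using 1 by (subst (asm) mult_left_cancel) auto
    with 1 show "\<sigma> x y \<in> {1, -1, \<i>, -\<i>} \<and> \<sigma> y x = cnj (\<sigma> x y)" by blast
  qed
  \<comment> \<open>This is the character value at the product of the monomials of \<open>u\<close>,
    \<open>a\<close>, \<open>b\<close> and the inverse of that of \<open>t\<close>: along a two-step
    path the monomial of the middle vertex cancels.\<close>
  define p where "p u a b t = bit_sign (\<beta> u a + \<beta> u b + \<beta> u t + \<beta> a b + \<beta> a t + \<beta> b t + \<beta> t t) *
    f (u + a + b + t)" for u a b t
  have path: "\<sigma> x (x + a) * \<sigma> (x + a) (x + a + b) = p (W x) (e a) (e b) (W (x + a + b))"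
    if x: "x \<in> Z2n n" and ab: "a \<in> S" "b \<in> S" for x a b
  proof -
    have V: "x + a \<in> Z2n n" "x + a + b \<in> Z2n n" using x ab S by (auto intro!: Z2n_add)
    have eqs: "x + (x + a) = a" "x + a + (x + a + b) = b"
      by (simp_all add: ac_simps)
    define u v t a' b' where "u = W x" and "v = W (x + a)" and "t = W (x + a + b)"
      and "a' = e a" and "b' = e b"
    have K1: "u + a' + v \<in> K" and K2: "v + b' + t \<in> K"
      using K_edge[of x "x + a"] K_edge[of "x + a" "x + a + b"] V x ab
      by (simp_all only: eqs u_def v_def t_def a'_def b'_def)
    have "f (u + a' + b' + t) = f ((u + a' + v) + (v + b' + t))"
      by (simp add: ac_simps)
    also have "\<dots> = bit_sign (\<beta> (u + a' + v) (v + b' + t)) * f (u + a' + v) * f (v + b' + t)"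
      by (rule fadd[OF K1 K2])
    finally have ff: "f (u + a' + b' + t) =
        bit_sign (\<beta> (u + a' + v) (v + b' + t)) * f (u + a' + v) * f (v + b' + t)" .
    have "\<sigma> x (x + a) * \<sigma> (x + a) (x + a + b) =
        bit_sign ((\<beta> u a' + \<beta> (u + a') v + \<beta> v v) + (\<beta> v b' + \<beta> (v + b') t + \<beta> t t)) *
        (f (u + a' + v) * f (v + b' + t))"
      unfolding \<sigma>_def Let_def eqs u_def[symmetric] v_def[symmetric] t_def[symmetric]
        a'_def[symmetric] b'_def[symmetric] bit_sign_add by (simp only: ac_simps)
    also have "(\<beta> u a' + \<beta> (u + a') v + \<beta> v v) + (\<beta> v b' + \<beta> (v + b') t + \<beta> t t) =
       (\<beta> u a' + \<beta> u b' + \<beta> u t + \<beta> a' b' + \<beta> a' t + \<beta> b' t + \<beta> t t) + \<beta> (u + a' + v) (v + b' + t)"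
      by (simp add: add_left add_right ac_simps)
    finally show ?thesis
      unfolding p_def u_def[symmetric] t_def[symmetric] a'_def[symmetric] b'_def[symmetric] ff
        bit_sign_add by (simp only: ac_simps)
  qed
  \<comment> \<open>Exchanging \<open>a\<close> and \<open>b\<close> affects only the term
    \<open>\<beta> (e a) (e b)\<close>, which flips because distinct generators anticommute.\<close>
  have p_swap: "p u (e a) (e b) t = - p u (e b) (e a) t" if "a \<in> S" "b \<in> S" "a \<noteq> b" for u a b t
  proof -
    have "\<beta> (e a) (e b) + \<beta> (e b) (e a) = 1"
      using clifford_form_commutator_indicator[OF fin r, of "{a}" "{b}"] that
      by (simp add: \<beta>_def e_def)
    then have "\<beta> (e a) (e b) = \<beta> (e b) (e a) + 1"
      by (cases "\<beta> (e a) (e b)"; cases "\<beta> (e b) (e a)") simp_all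
    then show ?thesis by (simp add: p_def bit_sign_add ac_simps)
  qed
  have "\<sigma> x (x + a) * \<sigma> (x + a) (x + a + b) = - (\<sigma> x (x + b) * \<sigma> (x + b) (x + a + b))"
    if "x \<in> Z2n n" "a \<in> S" "b \<in> S" "a \<noteq> b" for x a b
    using path[of x a b] path[of x b a] p_swap[of a b] that by (simp add: ac_simps)
  then have "unitary_signing (QS n S) \<sigma>"
    using C by (simp add: unitary_signing_QS_iff[OF S])
  moreover have "\<forall>(x, y)\<in>parcs (QS n S). \<sigma> x y \<in> U"
    using \<sigma>_U by (auto simp: QS_def)
  ultimately show ?thesis using that by blast
qed

theorem theorem5p6:
  fixes n :: nat and S :: "(nat \<Rightarrow> bit) set"
  assumes "S \<subseteq> Z2n n"
    and "0 \<notin> S"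
    and "sidon S"
    and "group_closure S = Z2n n"
  shows "((\<exists>\<sigma>. unitary_signing (QS n S) \<sigma>) \<longleftrightarrow> theta_property S) \<and>
    ((\<exists>\<sigma>. orthogonal_signing (QS n S) \<sigma>) \<longleftrightarrow>
      theta_property S \<and>
      \<not> (\<exists>D. minimal_dependency_relation S D \<and> card D mod 4 \<in> {2, 3}))"
proof -
  have fin: "finite S" using assms(1) finite_Z2n finite_subset by blast
  have edge: "(x, x + s) \<in> parcs (QS n S)" if "x \<in> Z2n n" "s \<in> S" for x s
    using that assms(1) by (auto simp: QS_def intro!: Z2n_add)
  have neg: "negative_signing n S \<sigma>" if "unitary_signing (QS n S) \<sigma>" for \<sigma>
    using that assms(1) edge complex_signing_mult_swap[of "QS n S" \<sigma>]
    unfolding unitary_signing_QS_iff[OF assms(1,3)]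
    by unfold_locales blast+
  have \<Theta>: "theta_property S" if "unitary_signing (QS n S) \<sigma>" for \<sigma>
    using negative_signing.dependency_even_parity[OF neg[OF that]] theta_property_iff[OF fin] by blast
  have "\<exists>\<sigma>. unitary_signing (QS n S) \<sigma>" if \<Theta>: "theta_property S"
  proof (rule signing_exists[OF assms(1,3,4) \<Theta>, of "{1, -1, \<i>, -\<i>}"])
    \<comment> \<open>Both signs are squares of fourth roots of unity, so sizes impose no condition
      here.\<close>
    show "\<exists>c\<in>{1, -1, \<i>, -\<i>}. c * c = bit_sign (of_nat (card D choose 2))" for D
      using bit_sign_cases[of "of_nat (card D choose 2)"] by auto
  qed auto
  moreover have "\<exists>\<sigma>. orthogonal_signing (QS n S) \<sigma>"
    if \<Theta>: "theta_property S"
      and min: "\<not> (\<exists>D. minimal_dependency_relation S D \<and> card D mod 4 \<in> {2, 3})"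
  proof (rule signing_exists[OF assms(1,3,4) \<Theta>, of "{1, -1}"])
    \<comment> \<open>Only the sign 1 has a root in this \<open>U\<close>, so every dependency
      relation must have size 0 or 1 modulo 4.\<close>
    show "\<exists>c\<in>{1, -1}. c * c = bit_sign (of_nat (card D choose 2))"
      if "dependency_relation S D" for D
    proof -
      have "even (card D choose 2)"
        using dependency_card_of_minimal[OF fin \<Theta> min that] by (simp only: even_choose_two_iff)
      then have "(of_nat (card D choose 2) :: bit) = 0"
        by (metis even_of_nat bit_not_zero_iff odd_one)
      then show ?thesis by simp
    qed
  qed (auto simp: orthogonal_signing_def)
  moreover have "\<not> (\<exists>D. minimal_dependency_relation S D \<and> card D mod 4 \<in> {2, 3})"
    if orth: "orthogonal_signing (QS n S) \<sigma>" for \<sigma>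
  proof -
    have U: "unitary_signing (QS n S) \<sigma>" using orth by (simp add: orthogonal_signing_def)
    have "\<sigma> x (x + s) \<in> {1, -1}" if "x \<in> Z2n n" "s \<in> S" for x s
      using orth edge[OF that] by (auto simp: orthogonal_signing_def)
    then have "card D mod 4 \<in> {0, 1}" if "dependency_relation S D" for D
      using negative_signing.dependency_real_card[OF neg[OF U]] that by blast
    then show ?thesis by (fastforce simp: minimal_dependency_relation_def)
  qed
  ultimately show ?thesis
    using \<Theta> by (auto simp: orthogonal_signing_def)
qed

end
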